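(* Let $X$ be a real Banach space, let $q\colon X\to\mathbb{R}$ be a continuous quadratic form, and let $T\colon X\to X^*$ be the symmetric operator that generates $q$, i.e. $q(x)=\langle Tx,x\rangle$ for all $x\in X$. Then the following assertions are equivalent: (i) $q$ is delta-semidefinite; (ii) there exists a continuous quadratic form $p$ on $X$ such that $|q|\le p$ on $X$; (iii) $T$ is factorizable through a Hilbert space.
   Context: All Banach spaces are real; "operator" means bounded linear operator. A function $q\colon X\to\mathbb{R}$ is a continuous quadratic form if there is a continuous bilinear form $b\colon X\times X\to\mathbb{R}$ with $q(x)=b(x,x)$ for all $x\in X$. An operator $T\colon X\to X^*$ is symmetric if $\langle Tx,y\rangle=\langle Ty,x\rangle$ for all $x,y\in X$. The formula $q(x)=\langle Tx,x\rangle$ is a one-to-one correspondence between continuous quadratic forms on $X$ and symmetric operators $T\colon X\to X^*$; one says $T$ generates $q$. A continuous quadratic form is delta-semidefinite if it is the difference of two nonnegative continuous quadratic forms on $X$. An operator $T\colon X\to Y$ is factorizable through $Z$ if there are operators $A\colon X\to Z$ and $B\colon Z\to Y$ with $T=BA$. *)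

theory Defs
  imports "HOL-Analysis.Analysis"
begin

definition continuous_quadratic_form :: "('a::real_normed_vector \<Rightarrow> real) \<Rightarrow> bool" where
  "continuous_quadratic_form q \<longleftrightarrow>
     (\<exists>b :: 'a \<Rightarrow> 'a \<Rightarrow> real. bounded_bilinear b \<and> (\<forall>x. q x = b x x))"

definition delta_semidefinite :: "('a::real_normed_vector \<Rightarrow> real) \<Rightarrow> bool" where
  "delta_semidefinite q \<longleftrightarrow>
     (\<exists>p1 p2. continuous_quadratic_form p1 \<and> (\<forall>x. 0 \<le> p1 x) \<and>
              continuous_quadratic_form p2 \<and> (\<forall>x. 0 \<le> p2 x) \<and>
              (\<forall>x. q x = p1 x - p2 x))"

definition symmetric_operator :: "('a::real_normed_vector \<Rightarrow>\<^sub>L 'a \<Rightarrow>\<^sub>L real) \<Rightarrow> bool" where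
  "symmetric_operator T \<longleftrightarrow>
     (\<forall>x y. blinfun_apply (blinfun_apply T x) y = blinfun_apply (blinfun_apply T y) x)"

definition generates :: "('a::real_normed_vector \<Rightarrow>\<^sub>L 'a \<Rightarrow>\<^sub>L real) \<Rightarrow> ('a \<Rightarrow> real) \<Rightarrow> bool" where
  "generates T q \<longleftrightarrow> (\<forall>x. q x = blinfun_apply (blinfun_apply T x) x)"

text \<open>
  HOL cannot quantify existentially over types, so a Hilbert space is given by a carrier set \<open>H\<close>
  and an inner product \<open>ip\<close>. The vector operations are those of the ambient type \<open>'v\<close>, which
  carries no topology; the norm comes from \<open>ip\<close> alone. The values of \<open>ip\<close> outside \<open>H\<close> are
  irrelevant.
\<close>

definition ip_norm :: "('v \<Rightarrow> 'v \<Rightarrow> real) \<Rightarrow> 'v \<Rightarrow> real" where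
  "ip_norm ip x = sqrt (ip x x)"

locale hilbert_space_on =
  fixes H :: "'v::real_vector set" and ip :: "'v \<Rightarrow> 'v \<Rightarrow> real"
  assumes subspace: "subspace H"
    and ip_commute: "\<lbrakk>x \<in> H; y \<in> H\<rbrakk> \<Longrightarrow> ip x y = ip y x"
    and ip_add_left: "\<lbrakk>x \<in> H; y \<in> H; z \<in> H\<rbrakk> \<Longrightarrow> ip (x + y) z = ip x z + ip y z"
    and ip_scaleR_left: "\<lbrakk>x \<in> H; y \<in> H\<rbrakk> \<Longrightarrow> ip (c *\<^sub>R x) y = c * ip x y"
    and ip_pos: "\<lbrakk>x \<in> H; x \<noteq> 0\<rbrakk> \<Longrightarrow> 0 < ip x x"
    and complete:
      "\<lbrakk>\<And>n. s n \<in> H; \<And>e. 0 < e \<Longrightarrow> \<exists>N. \<forall>m\<ge>N. \<forall>n\<ge>N. ip_norm ip (s m - s n) < e\<rbrakk>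
       \<Longrightarrow> \<exists>l\<in>H. (\<lambda>n. ip_norm ip (s n - l)) \<longlonglongrightarrow> 0"

definition bounded_linear_into ::
    "'v::real_vector set \<Rightarrow> ('v \<Rightarrow> 'v \<Rightarrow> real) \<Rightarrow> ('a::real_normed_vector \<Rightarrow> 'v) \<Rightarrow> bool" where
  "bounded_linear_into H ip A \<longleftrightarrow>
     linear A \<and> range A \<subseteq> H \<and> (\<exists>K. \<forall>x. ip_norm ip (A x) \<le> K * norm x)"

definition bounded_linear_from ::
    "'v::real_vector set \<Rightarrow> ('v \<Rightarrow> 'v \<Rightarrow> real) \<Rightarrow> ('v \<Rightarrow> 'b::real_normed_vector) \<Rightarrow> bool" where
  "bounded_linear_from H ip B \<longleftrightarrow>
     (\<forall>x\<in>H. \<forall>y\<in>H. B (x + y) = B x + B y) \<and>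
     (\<forall>c. \<forall>x\<in>H. B (c *\<^sub>R x) = c *\<^sub>R B x) \<and>
     (\<exists>K. \<forall>x\<in>H. norm (B x) \<le> K * ip_norm ip x)"

text \<open>The type argument is the ambient type in which the carrier of the Hilbert space lives.\<close>

definition factorizable_through_hilbert ::
    "'v::real_vector itself \<Rightarrow> ('a::real_normed_vector \<Rightarrow>\<^sub>L 'b::real_normed_vector) \<Rightarrow> bool" where
  "factorizable_through_hilbert _ T \<longleftrightarrow>
     (\<exists>(H :: 'v set) ip A B. hilbert_space_on H ip \<and>
        bounded_linear_into H ip A \<and> bounded_linear_from H ip B \<and>
        (\<forall>x. blinfun_apply T x = B (A x)))"

text \<open>
  For operators into the dual \<open>'a \<Rightarrow>\<^sub>L real\<close> of the domain, taking this dual as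
  ambient type loses no generality: given \<open>T = B A\<close> through some Hilbert space, replace that space
  by the closure \<open>Z\<close> of the range of \<open>A\<close>; the map sending \<open>z\<close> in \<open>Z\<close> to the functional mapping
  \<open>x\<close> to \<open>ip z (A x)\<close> is linear and injective, so \<open>Z\<close> can be carried over to a linear subspace of
  the dual with the transported inner product. A theorem that wants to speak about
  all Hilbert spaces can in addition leave \<open>'v\<close> as a free type variable.
\<close>

end

theory Submission
  imports Defs
begin

text \<open>
  The first two assertions are equivalent by an elementary exchange: if
  \<open>q = p\<^sub>1 - p\<^sub>2\<close> with nonnegative \<open>p\<^sub>1\<close> and \<open>p\<^sub>2\<close>, then \<open>\<bar>q\<bar> \<le> p\<^sub>1 + p\<^sub>2\<close>, and if \<open>\<bar>q\<bar> \<le> p\<close>, then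
  \<open>q = (p + q) / 2 - (p - q) / 2\<close>.

  The link to factorizations is a single construction, used in both directions. Let \<open>P\<close> be a
  nonnegative quadratic form on a space \<open>D\<close>, and let \<open>\<beta>\<close> be a bilinear pairing of a second space
  with \<open>D\<close>. The energy \<open>E f = sup (2 \<beta> f x - P x)\<close>, taken over \<open>x\<close> in \<open>D\<close>, is the convex conjugate
  of \<open>P\<close> up to normalisation; where it is finite, it is the square of the norm of \<open>f\<close> as a functional
  on \<open>D\<close> with the square root of \<open>P\<close> as seminorm. Because \<open>P\<close> satisfies the parallelogram law, so
  does \<open>E\<close>: the substitution \<open>x = u + v\<close>, \<open>y = u - v\<close> under two suprema gives one inequality
  (\<open>energy_parallelogram_le\<close>), and homogeneity turns it around. By the argument of Jordan and
  von Neumann (\<open>polar_add_left\<close>, \<open>polar_scale_left\<close>), \<open>E\<close> is itself a quadratic form on the space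
  where it is finite.

  Suppose that \<open>T = B A\<close> factors through \<open>H\<close> (\<open>factorizable_imp_dominated\<close>). Let \<open>E x\<close> be the energy
  of \<open>x\<close> relative to the squared norm of \<open>H\<close> and the pairing \<open>B h x\<close>; in effect \<open>E x\<close> is the squared norm
  of the image of \<open>x\<close> under the adjoint of \<open>B\<close>, and continuity of \<open>B\<close> bounds it by a multiple of \<open>\<parallel>x\<parallel>\<^sup>2\<close>.
  The definition of \<open>E\<close> as a supremum contains the inequality \<open>2 \<bar>B h x\<bar> \<le> E x + \<parallel>h\<parallel>\<^sup>2\<close>, and \<open>h = A x\<close> gives
  the majorant \<open>(E x + \<parallel>A x\<parallel>\<^sup>2) / 2\<close> of \<open>\<bar>q x\<bar>\<close>.

  Conversely let \<open>\<bar>q\<bar> \<le> p\<close> (\<open>dominated_imp_factorizable\<close>), and let \<open>b\<close> be the symmetric bilinear form of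
  \<open>p\<close>. Let \<open>H\<close> consist of the continuous functionals on \<open>X\<close> that have finite energy relative to \<open>p\<close>. It is
  complete for the energy norm (\<open>hilbert_space_finite_energy\<close>), and it is the Hilbert space with
  reproducing kernel \<open>b\<close>: if \<open>A x\<close> is the functional sending \<open>y\<close> to \<open>b x y\<close>, then the inner product of \<open>f\<close>
  and \<open>A x\<close> is \<open>f x\<close> (\<open>energy_polar_representer\<close>). The bound \<open>\<bar>q\<bar> \<le> p\<close> polarises to
  \<open>2 \<langle>T y, x\<rangle> \<le> p x + p y\<close>, which says that \<open>T y\<close> has energy at most \<open>p y\<close>. Hence letting \<open>B f\<close> send \<open>y\<close> to
  the inner product of \<open>f\<close> and \<open>T y\<close> defines a bounded operator from \<open>H\<close> to the dual of \<open>X\<close>, and the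
  reproducing property together with the symmetry of \<open>T\<close> yields \<open>B (A x) = T x\<close>.
\<close>

section \<open>Two facts about real functions\<close>

text \<open>
  The defect \<open>k t = h t - t h 1\<close> is additive and vanishes at the integers, so its values are
  those on \<open>[0, 1]\<close> and it is bounded; but \<open>k (n t) = n k t\<close> is unbounded unless \<open>k = 0\<close>.
\<close>

lemma additive_locally_bounded_imp_linear:
  fixes h :: "real \<Rightarrow> real"
  assumes add: "\<And>s t. h (s + t) = h s + h t"
    and bound: "\<And>t. \<bar>t\<bar> \<le> 1 \<Longrightarrow> \<bar>h t\<bar> \<le> M"
  shows "h t = t * h 1"
proof -
  define k where "k t = h t - t * h 1" for t
  have k_add: "k (s + t) = k s + k t" for s t
    by (simp add: k_def add algebra_simps)
  interpret k: additive k
    by unfold_locales (rule k_add)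
  have k_mult: "k (real n * t) = real n * k t" for n t
    by (induction n) (simp_all add: k.zero k_add algebra_simps)
  have k_nat: "k (real n) = 0" for n
    using k_mult[of n 1] by (simp add: k_def)
  have k_int: "k (of_int i) = 0" for i
    by (cases i rule: int_cases2) (simp_all add: k_nat k.minus)
  have k_bound: "\<bar>k t\<bar> \<le> M + \<bar>h 1\<bar>" for t
  proof -
    have "k t = k (frac t)"
      using k_add[of "of_int \<lfloor>t\<rfloor>" "frac t"] by (simp add: k_int frac_def)
    moreover have frac: "\<bar>frac t\<bar> \<le> 1"
      using frac_ge_0[of t] frac_lt_1[of t] by linarith
    moreover have "\<bar>frac t * h 1\<bar> \<le> 1 * \<bar>h 1\<bar>"
      unfolding abs_mult using frac by (rule mult_right_mono) simp
    moreover have "\<bar>h (frac t)\<bar> \<le> M"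
      using frac by (rule bound)
    ultimately show ?thesis
      unfolding k_def by linarith
  qed
  have "k t = 0"
  proof (rule ccontr)
    assume "k t \<noteq> 0"
    then obtain n where "M + \<bar>h 1\<bar> < real n * \<bar>k t\<bar>"
      using reals_Archimedean3[of "\<bar>k t\<bar>"] by auto
    with k_bound[of "real n * t"] show False
      by (simp add: k_mult abs_mult)
  qed
  then show ?thesis by (simp add: k_def)
qed

lemma quadratic_nonneg_imp_discriminant:
  fixes a b c :: real
  assumes nonneg: "\<And>t. 0 \<le> a + 2 * t * b + t\<^sup>2 * c" and "0 \<le> c"
  shows "b\<^sup>2 \<le> a * c"
proof (cases "c = 0")
  case True
  have "b = 0"
  proof (rule ccontr)
    assume "b \<noteq> 0"
    with nonneg[of "- (a + 1) / (2 * b)"] True show False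
      by (simp add: field_simps)
  qed
  with True show ?thesis by simp
next
  case False
  with \<open>0 \<le> c\<close> have "0 < c" by simp
  with nonneg[of "- b / c"] show ?thesis
    by (simp add: field_simps power2_eq_square)
qed

section \<open>Forms that satisfy the parallelogram law\<close>

locale parallelogram_form =
  fixes V :: "'u::real_vector set" and N :: "'u \<Rightarrow> real"
  assumes subspace: "subspace V"
    and nonneg: "f \<in> V \<Longrightarrow> 0 \<le> N f"
    and scale: "f \<in> V \<Longrightarrow> N (c *\<^sub>R f) = c\<^sup>2 * N f"
    and parallelogram: "\<lbrakk>f \<in> V; g \<in> V\<rbrakk> \<Longrightarrow> N (f + g) + N (f - g) = 2 * N f + 2 * N g"
begin

definition polar :: "'u \<Rightarrow> 'u \<Rightarrow> real" where
  "polar f g = (N (f + g) - N (f - g)) / 4"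

lemmas mem = subspace_0[OF subspace] subspace_add[OF subspace] subspace_diff[OF subspace]
  subspace_scale[OF subspace] subspace_neg[OF subspace]

lemma form_0 [simp]: "N 0 = 0"
  using scale[of 0 0] mem(1) by simp

lemma form_minus: "f \<in> V \<Longrightarrow> N (- f) = N f"
  using scale[of f "- 1"] by simp

lemma form_diff_commute: "\<lbrakk>f \<in> V; g \<in> V\<rbrakk> \<Longrightarrow> N (f - g) = N (g - f)"
  using form_minus[of "f - g"] mem by simp

lemma polar_self: "f \<in> V \<Longrightarrow> polar f f = N f"
  using scale[of f 2] by (simp add: polar_def scaleR_2)

lemma polar_commute: "\<lbrakk>f \<in> V; g \<in> V\<rbrakk> \<Longrightarrow> polar f g = polar g f"
  by (simp add: polar_def add.commute form_diff_commute)

lemma form_add: "\<lbrakk>f \<in> V; g \<in> V\<rbrakk> \<Longrightarrow> N (f + g) = N f + 2 * polar f g + N g"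
  using parallelogram[of f g] by (simp add: polar_def field_simps)

lemma abs_polar_le_mean: "\<lbrakk>f \<in> V; g \<in> V\<rbrakk> \<Longrightarrow> \<bar>polar f g\<bar> \<le> (N f + N g) / 2"
  using parallelogram[of f g] nonneg[of "f + g"] nonneg[of "f - g"] mem
  by (simp add: polar_def field_simps abs_le_iff)

text \<open>
  Apply the parallelogram law to the pairs \<open>f + h\<close>, \<open>g\<close> and \<open>f - h\<close>, \<open>g\<close>, and subtract: the terms
  \<open>N g\<close> cancel.
\<close>

lemma polar_midpoint:
  assumes "f \<in> V" "g \<in> V" "h \<in> V"
  shows "polar (f + g) h + polar (f - g) h = 2 * polar f h"
proof -
  have "N (f + g + h) + N (f - g + h) = 2 * N (f + h) + 2 * N g"
    using parallelogram[of "f + h" g] assms mem by (simp add: algebra_simps)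
  moreover have "N (f + g - h) + N (f - g - h) = 2 * N (f - h) + 2 * N g"
    using parallelogram[of "f - h" g] assms mem by (simp add: algebra_simps)
  ultimately show ?thesis
    by (simp add: polar_def field_simps)
qed

lemma polar_zero_left: "h \<in> V \<Longrightarrow> polar 0 h = 0"
  by (simp add: polar_def form_minus)

text \<open>
  The midpoint identity says that \<open>polar \<cdot> h\<close> is affine at midpoints; since it vanishes at \<open>0\<close>,
  it is additive.
\<close>

lemma polar_add_left:
  assumes "f \<in> V" "g \<in> V" "h \<in> V"
  shows "polar (f + g) h = polar f h + polar g h"
proof -
  have double: "polar (u + u) h = 2 * polar u h" if "u \<in> V" for u
    using polar_midpoint[OF that that \<open>h \<in> V\<close>] polar_zero_left[OF \<open>h \<in> V\<close>] by simp
  define u where "u = (1/2) *\<^sub>R (f + g)"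
  define v where "v = (1/2) *\<^sub>R (f - g)"
  have uv: "u \<in> V" "v \<in> V"
    using assms mem by (auto simp: u_def v_def)
  have "u + u = f + g"
    by (simp add: u_def flip: scaleR_2)
  moreover have "u + v = f" "u - v = g"
    by (simp_all add: u_def v_def algebra_simps flip: scaleR_left_distrib)
  ultimately show ?thesis
    using polar_midpoint[OF uv \<open>h \<in> V\<close>] double[OF uv(1)] by simp
qed

text \<open>
  Additivity alone gives homogeneity for rational factors; the bound by the mean of \<open>N f\<close> and \<open>N g\<close>
  keeps \<open>polar (t f) g\<close> bounded for \<open>\<bar>t\<bar> \<le> 1\<close>, which extends it to real factors.
\<close>

lemma polar_scale_left:
  assumes "f \<in> V" "g \<in> V"
  shows "polar (c *\<^sub>R f) g = c * polar f g"
proof -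
  have "polar (c *\<^sub>R f) g = c * polar (1 *\<^sub>R f) g"
  proof (rule additive_locally_bounded_imp_linear[where M = "(N f + N g) / 2"])
    show "polar ((s + t) *\<^sub>R f) g = polar (s *\<^sub>R f) g + polar (t *\<^sub>R f) g" for s t
      using assms mem by (simp add: scaleR_left_distrib polar_add_left)
    fix t :: real
    assume "\<bar>t\<bar> \<le> 1"
    then have "t\<^sup>2 * N f \<le> N f"
      using nonneg[OF \<open>f \<in> V\<close>] abs_square_le_1[of t] mult_right_mono[of "t\<^sup>2" 1 "N f"] by simp
    with abs_polar_le_mean[of "t *\<^sub>R f" g] show "\<bar>polar (t *\<^sub>R f) g\<bar> \<le> (N f + N g) / 2"
      using assms mem by (simp add: scale)
  qed
  then show ?thesis by simp
qed

lemma polar_add_right: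
  "\<lbrakk>f \<in> V; g \<in> V; h \<in> V\<rbrakk> \<Longrightarrow> polar f (g + h) = polar f g + polar f h"
  by (simp add: polar_commute[of f] polar_add_left mem)

lemma polar_scale_right: "\<lbrakk>f \<in> V; g \<in> V\<rbrakk> \<Longrightarrow> polar f (c *\<^sub>R g) = c * polar f g"
  by (simp add: polar_commute[of f] polar_scale_left mem)

lemma polar_Cauchy_Schwarz:
  assumes "f \<in> V" "g \<in> V"
  shows "\<bar>polar f g\<bar> \<le> sqrt (N f) * sqrt (N g)"
proof -
  have "0 \<le> N f + 2 * t * polar f g + t\<^sup>2 * N g" for t
    using nonneg[of "f + t *\<^sub>R g"] assms mem
    by (simp add: form_add polar_scale_right scale)
  then have "(polar f g)\<^sup>2 \<le> N f * N g"
    by (rule quadratic_nonneg_imp_discriminant) (rule nonneg[OF \<open>g \<in> V\<close>])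
  then show ?thesis
    using real_sqrt_le_mono by (fastforce simp: real_sqrt_mult)
qed

end

text \<open>
  By the Cauchy-Schwarz inequality, the bound for \<open>N\<close> carries over to its polar form.
\<close>

lemma bounded_parallelogram_form_imp_continuous_quadratic_form:
  fixes N :: "'a::real_normed_vector \<Rightarrow> real"
  assumes "parallelogram_form UNIV N" and bound: "\<And>x. N x \<le> (K * norm x)\<^sup>2"
  shows "continuous_quadratic_form N"
proof -
  interpret parallelogram_form UNIV N by fact
  have sqrt_le: "sqrt (N x) \<le> \<bar>K\<bar> * norm x" for x
    using real_sqrt_le_mono[OF bound[of x]] by (simp add: abs_mult)
  have "\<bar>polar x y\<bar> \<le> norm x * norm y * (\<bar>K\<bar> * \<bar>K\<bar>)" for x y
  proof -
    have "\<bar>polar x y\<bar> \<le> sqrt (N x) * sqrt (N y)"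
      by (rule polar_Cauchy_Schwarz) auto
    also have "\<dots> \<le> (\<bar>K\<bar> * norm x) * (\<bar>K\<bar> * norm y)"
      by (intro mult_mono sqrt_le) (auto simp: nonneg)
    finally show ?thesis by (simp add: mult_ac)
  qed
  then have "bounded_bilinear polar"
    by unfold_locales
      (auto simp: polar_add_left polar_add_right polar_scale_left polar_scale_right)
  then show ?thesis
    unfolding continuous_quadratic_form_def by (metis polar_self UNIV_I)
qed

section \<open>The energy of a functional relative to a quadratic form\<close>

locale paired_parallelogram_form = P: parallelogram_form D P
  for D :: "'w::real_vector set" and P :: "'w \<Rightarrow> real" +
  fixes \<beta> :: "'u::real_vector \<Rightarrow> 'w \<Rightarrow> real"
  assumes pair_add_left: "x \<in> D \<Longrightarrow> \<beta> (f + g) x = \<beta> f x + \<beta> g x"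
    and pair_scale_left: "x \<in> D \<Longrightarrow> \<beta> (c *\<^sub>R f) x = c * \<beta> f x"
    and pair_add_right: "\<lbrakk>x \<in> D; y \<in> D\<rbrakk> \<Longrightarrow> \<beta> f (x + y) = \<beta> f x + \<beta> f y"
    and pair_scale_right: "x \<in> D \<Longrightarrow> \<beta> f (c *\<^sub>R x) = c * \<beta> f x"
begin

definition finite_energy :: "'u set" where
  "finite_energy = {f. bdd_above ((\<lambda>x. 2 * \<beta> f x - P x) ` D)}"

text \<open>
  The factor \<open>2\<close> makes the supremum equal to the squared dual norm: along a line, the maximum of
  \<open>2 t \<beta> f x - t\<^sup>2 P x\<close> over \<open>t\<close> is \<open>(\<beta> f x)\<^sup>2 / P x\<close>.
\<close>

definition energy :: "'u \<Rightarrow> real" where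
  "energy f = (SUP x\<in>D. 2 * \<beta> f x - P x)"

lemma pair_zero [simp]: "x \<in> D \<Longrightarrow> \<beta> 0 x = 0" "\<beta> f 0 = 0"
  using pair_scale_left[of x 0 0] pair_scale_right[of 0 f 0] P.mem(1) by simp_all

lemma finite_energyI: "(\<And>x. x \<in> D \<Longrightarrow> 2 * \<beta> f x - P x \<le> C) \<Longrightarrow> f \<in> finite_energy"
  unfolding finite_energy_def by (auto intro!: bdd_aboveI2)

lemma energy_leI: "(\<And>x. x \<in> D \<Longrightarrow> 2 * \<beta> f x - P x \<le> C) \<Longrightarrow> energy f \<le> C"
  unfolding energy_def using P.mem(1) by (intro cSUP_least) auto

lemma energy_upper: "\<lbrakk>f \<in> finite_energy; x \<in> D\<rbrakk> \<Longrightarrow> 2 * \<beta> f x - P x \<le> energy f"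
  unfolding energy_def finite_energy_def by (auto intro: cSUP_upper)

lemma energy_nonneg: "f \<in> finite_energy \<Longrightarrow> 0 \<le> energy f"
  using energy_upper[OF _ P.mem(1), of f] by simp

text \<open>
  Testing \<open>c f\<close> at \<open>x\<close> gives \<open>c\<^sup>2\<close> times the value of testing \<open>f\<close> at \<open>x / c\<close>.
\<close>

lemma energy_scale_bound:
  assumes "f \<in> finite_energy" "x \<in> D" "c \<noteq> 0"
  shows "2 * \<beta> (c *\<^sub>R f) x - P x \<le> c\<^sup>2 * energy f"
proof -
  have "2 * \<beta> (c *\<^sub>R f) x - P x = c\<^sup>2 * (2 * \<beta> f ((1/c) *\<^sub>R x) - P ((1/c) *\<^sub>R x))"
    using assms by (simp add: pair_scale_left pair_scale_right P.scale field_simps power2_eq_square)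
  also have "\<dots> \<le> c\<^sup>2 * energy f"
    using assms P.mem(4) by (intro mult_left_mono energy_upper) auto
  finally show ?thesis .
qed

lemma finite_energy_scale: "f \<in> finite_energy \<Longrightarrow> c *\<^sub>R f \<in> finite_energy"
  by (cases "c = 0")
    (auto intro: finite_energyI[where C = 0] finite_energyI[OF energy_scale_bound] simp: P.nonneg)

lemma energy_scale:
  assumes "f \<in> finite_energy"
  shows "energy (c *\<^sub>R f) = c\<^sup>2 * energy f"
proof (cases "c = 0")
  case True
  have "energy 0 \<le> 0"
    by (intro energy_leI) (simp add: P.nonneg)
  moreover have "0 \<le> energy 0"
    using energy_nonneg[OF finite_energy_scale[OF assms, of 0]] by simp
  ultimately show ?thesis using True by simp
next
  case False
  have le: "energy (a *\<^sub>R g) \<le> a\<^sup>2 * energy g" if "g \<in> finite_energy" "a \<noteq> 0" for a g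
    by (intro energy_leI energy_scale_bound that)
  have "energy f \<le> (1/c)\<^sup>2 * energy (c *\<^sub>R f)"
    using le[OF finite_energy_scale[OF assms], of "1/c" c] False by simp
  then have "c\<^sup>2 * energy f \<le> energy (c *\<^sub>R f)"
    using False by (simp add: field_simps)
  with le[OF assms False] show ?thesis by simp
qed

text \<open>
  The half-sum and the half-difference of test points \<open>x\<close> for \<open>f + g\<close> and \<open>y\<close> for \<open>f - g\<close> are test points
  for \<open>f\<close> and \<open>g\<close>; the penalties match by the parallelogram law of \<open>P\<close>.
\<close>

lemma energy_test_points:
  assumes "f \<in> finite_energy" "g \<in> finite_energy" "x \<in> D" "y \<in> D"
  shows "(2 * \<beta> (f + g) x - P x) + (2 * \<beta> (f - g) y - P y) \<le> 2 * energy f + 2 * energy g"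
proof -
  define u where "u = (1/2) *\<^sub>R (x + y)"
  define v where "v = (1/2) *\<^sub>R (x - y)"
  have uv: "u \<in> D" "v \<in> D"
    using assms P.mem by (auto simp: u_def v_def)
  have xy: "x = u + v" "y = u - v"
    by (simp_all add: u_def v_def algebra_simps flip: scaleR_left_distrib)
  have diff_left: "\<beta> (f - g) z = \<beta> f z - \<beta> g z" if "z \<in> D" for z
    using pair_add_left[OF that, of f "- g"] pair_scale_left[OF that, of "- 1" g] by simp
  have diff_right: "\<beta> h (u - v) = \<beta> h u - \<beta> h v" for h
    using pair_add_right[of u "- v" h] pair_scale_right[of v h "- 1"] uv P.mem by simp
  have "(2 * \<beta> (f + g) x - P x) + (2 * \<beta> (f - g) y - P y)
      = 2 * (2 * \<beta> f u - P u) + 2 * (2 * \<beta> g v - P v)"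
    using P.parallelogram[OF uv] uv P.mem
    by (simp add: xy pair_add_left diff_left pair_add_right diff_right)
  also have "\<dots> \<le> 2 * energy f + 2 * energy g"
    using energy_upper[OF assms(1) uv(1)] energy_upper[OF assms(2) uv(2)] by simp
  finally show ?thesis .
qed

lemma finite_energy_add:
  assumes "f \<in> finite_energy" "g \<in> finite_energy"
  shows "f + g \<in> finite_energy"
  using energy_test_points[OF assms _ P.mem(1)]
  by (intro finite_energyI[where C = "2 * energy f + 2 * energy g"]) simp

lemma subspace_finite_energy: "subspace finite_energy"
proof -
  have "0 \<in> finite_energy"
    by (rule finite_energyI[where C = 0]) (simp add: P.nonneg)
  then show ?thesis
    by (simp add: subspace_def finite_energy_add finite_energy_scale)
qed

lemma energy_parallelogram_le:
  assumes "f \<in> finite_energy" "g \<in> finite_energy"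
  shows "energy (f + g) + energy (f - g) \<le> 2 * energy f + 2 * energy g"
proof -
  let ?C = "2 * energy f + 2 * energy g"
  have "energy (f - g) \<le> ?C - (2 * \<beta> (f + g) x - P x)" if "x \<in> D" for x
    using energy_test_points[OF assms that] by (intro energy_leI) (simp add: algebra_simps)
  then have "energy (f + g) \<le> ?C - energy (f - g)"
    by (intro energy_leI) (simp add: algebra_simps)
  then show ?thesis by simp
qed

text \<open>
  The reverse inequality is the same one, applied to \<open>f + g\<close> and \<open>f - g\<close>, whose sum and difference are
  \<open>2 f\<close> and \<open>2 g\<close>.
\<close>

sublocale energy: parallelogram_form finite_energy energy
proof
  show "subspace finite_energy" by (rule subspace_finite_energy)
next
  fix f g assume fg: "f \<in> finite_energy" "g \<in> finite_energy"
  have "(f + g) + (f - g) = 2 *\<^sub>R f" "(f + g) - (f - g) = 2 *\<^sub>R g"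
    by (simp_all add: scaleR_2)
  with energy_parallelogram_le[of "f + g" "f - g"]
  have "4 * energy f + 4 * energy g \<le> 2 * energy (f + g) + 2 * energy (f - g)"
    using fg subspace_diff[OF subspace_finite_energy fg]
    by (simp add: finite_energy_add energy_scale)
  with energy_parallelogram_le[OF fg]
  show "energy (f + g) + energy (f - g) = 2 * energy f + 2 * energy g" by simp
qed (auto intro: energy_nonneg energy_scale)

lemma pair_square_le_energy:
  assumes "f \<in> finite_energy" "x \<in> D"
  shows "(\<beta> f x)\<^sup>2 \<le> energy f * P x"
proof (rule quadratic_nonneg_imp_discriminant)
  fix t
  show "0 \<le> energy f + 2 * t * \<beta> f x + t\<^sup>2 * P x"
    using energy_upper[OF assms(1) P.mem(4)[OF assms(2)], of "- t"] assms
      pair_scale_right[OF assms(2), of f "- t"] P.scale[OF assms(2), of "- t"]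
    by simp
  show "0 \<le> P x" by (rule P.nonneg[OF assms(2)])
qed

text \<open>
  Completing the square: \<open>2 P.polar x y - P y = P x - P (y - x)\<close>, so adding to \<open>f\<close> the functional \<open>a\<close>
  that the polar form attaches to \<open>x\<close> only translates the test point by \<open>x\<close>, up to constants.
\<close>

lemma energy_add_representer_bound:
  assumes f: "f \<in> finite_energy" and x: "x \<in> D" and a: "\<And>y. y \<in> D \<Longrightarrow> \<beta> a y = P.polar x y"
  shows "f + a \<in> finite_energy" "energy (f + a) \<le> energy f + 2 * \<beta> f x + P x"
proof -
  have le: "2 * \<beta> (f + a) y - P y \<le> energy f + 2 * \<beta> f x + P x" if "y \<in> D" for y
  proof -
    have z: "y - x \<in> D" using that x P.mem by simp
    have "\<beta> f y = \<beta> f (y - x) + \<beta> f x"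
      using pair_add_right[OF z x, of f] by simp
    moreover have "P y = P (y - x) + 2 * P.polar (y - x) x + P x"
      using P.form_add[OF z x] by simp
    moreover have "P.polar x y = P.polar (y - x) x + P x"
      using P.polar_add_left[OF z x x] that x by (simp add: P.polar_self P.polar_commute)
    ultimately have "2 * \<beta> (f + a) y - P y = (2 * \<beta> f (y - x) - P (y - x)) + 2 * \<beta> f x + P x"
      using that by (simp add: pair_add_left a)
    with energy_upper[OF f z] show ?thesis by simp
  qed
  show "f + a \<in> finite_energy" by (rule finite_energyI[OF le])
  show "energy (f + a) \<le> energy f + 2 * \<beta> f x + P x" by (rule energy_leI[OF le])
qed

lemma representer_finite_energy:
  assumes "x \<in> D" "\<And>y. y \<in> D \<Longrightarrow> \<beta> a y = P.polar x y"
  shows "a \<in> finite_energy"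
  using energy_add_representer_bound(1)[OF energy.mem(1) assms] by simp

text \<open>
  The bound \<open>energy f + 2 \<beta> f x + P x\<close> for the energy of \<open>f + a\<close> is an equality, since translating back
  with \<open>- a\<close> and \<open>- x\<close> returns to \<open>f\<close>; its cross term identifies the polar form. This is the
  reproducing property.
\<close>

lemma energy_polar_representer:
  assumes f: "f \<in> finite_energy" and x: "x \<in> D" and a: "\<And>y. y \<in> D \<Longrightarrow> \<beta> a y = P.polar x y"
  shows "energy.polar f a = \<beta> f x" and "energy a = P x"
proof -
  have x': "- x \<in> D" using x P.mem by simp
  have a': "\<beta> (- a) y = P.polar (- x) y" if "y \<in> D" for y
    using pair_scale_left[OF that, of "- 1" a] P.polar_scale_left[OF x that, of "- 1"] a[OF that]
    by simp
  have neg: "\<beta> g (- x) = - \<beta> g x" for g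
    using pair_scale_right[OF x, of g "- 1"] by simp
  have shift: "energy (g + a) = energy g + 2 * \<beta> g x + P x" if g: "g \<in> finite_energy" for g
  proof -
    have "energy g \<le> energy (g + a) - 2 * \<beta> (g + a) x + P x"
      using energy_add_representer_bound(2)[OF energy_add_representer_bound(1)[OF g x a] x' a']
      by (simp add: neg P.form_minus x)
    moreover have "\<beta> (g + a) x = \<beta> g x + P x"
      using x by (simp add: pair_add_left a P.polar_self)
    ultimately show ?thesis
      using energy_add_representer_bound(2)[OF g x a] by simp
  qed
  show "energy a = P x"
    using shift[OF energy.mem(1)] x by simp
  with energy.form_add[OF f representer_finite_energy[OF x a]] shift[OF f]
  show "energy.polar f a = \<beta> f x" by simp
qed

end

section \<open>Majorants and differences of nonnegative forms\<close>

lemma continuous_quadratic_form_linear_combination: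
  assumes "continuous_quadratic_form p" "continuous_quadratic_form q"
  shows "continuous_quadratic_form (\<lambda>x. c * p x + d * q x)"
proof -
  obtain b b' where b: "bounded_bilinear b" "\<And>x. p x = b x x"
    and b': "bounded_bilinear b'" "\<And>x. q x = b' x x"
    using assms unfolding continuous_quadratic_form_def by blast
  interpret b: bounded_bilinear b by (rule b(1))
  interpret b': bounded_bilinear b' by (rule b'(1))
  obtain K L where K: "\<And>x y. norm (b x y) \<le> norm x * norm y * K"
    and L: "\<And>x y. norm (b' x y) \<le> norm x * norm y * L"
    using b.bounded b'.bounded by blast
  have "norm (c * b x y + d * b' x y) \<le> norm x * norm y * (\<bar>c\<bar> * K + \<bar>d\<bar> * L)" for x y
  proof -
    have "norm (c * b x y + d * b' x y) \<le> \<bar>c\<bar> * norm (b x y) + \<bar>d\<bar> * norm (b' x y)"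
      using norm_triangle_ineq[of "c * b x y" "d * b' x y"] by (simp add: abs_mult)
    also have "\<dots> \<le> \<bar>c\<bar> * (norm x * norm y * K) + \<bar>d\<bar> * (norm x * norm y * L)"
      by (intro add_mono mult_left_mono K L) auto
    finally show ?thesis by (simp add: algebra_simps)
  qed
  then have bounded: "\<exists>M. \<forall>x y. norm (c * b x y + d * b' x y) \<le> norm x * norm y * M"
    by blast
  have "bounded_bilinear (\<lambda>x y. c * b x y + d * b' x y)"
    by (unfold_locales; (rule bounded)?)
      (simp_all add: b.add_left b.add_right b'.add_left b'.add_right b.scaleR_left b.scaleR_right
        b'.scaleR_left b'.scaleR_right algebra_simps)
  then show ?thesis
    unfolding continuous_quadratic_form_def using b(2) b'(2) by auto
qed

lemma delta_semidefinite_iff_dominated: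
  assumes q: "continuous_quadratic_form q"
  shows "delta_semidefinite q \<longleftrightarrow> (\<exists>p. continuous_quadratic_form p \<and> (\<forall>x. \<bar>q x\<bar> \<le> p x))"
proof
  assume "delta_semidefinite q"
  then obtain p1 p2 where p: "continuous_quadratic_form p1" "\<And>x. 0 \<le> p1 x"
    "continuous_quadratic_form p2" "\<And>x. 0 \<le> p2 x" "\<And>x. q x = p1 x - p2 x"
    unfolding delta_semidefinite_def by blast
  have "continuous_quadratic_form (\<lambda>x. p1 x + p2 x)"
    using continuous_quadratic_form_linear_combination[OF p(1,3), of 1 1] by simp
  moreover have "\<bar>q x\<bar> \<le> p1 x + p2 x" for x
    using p(2)[of x] p(4)[of x] p(5)[of x] by linarith
  ultimately show "\<exists>p. continuous_quadratic_form p \<and> (\<forall>x. \<bar>q x\<bar> \<le> p x)"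
    by blast
next
  assume "\<exists>p. continuous_quadratic_form p \<and> (\<forall>x. \<bar>q x\<bar> \<le> p x)"
  then obtain p where p: "continuous_quadratic_form p" "\<And>x. \<bar>q x\<bar> \<le> p x"
    by blast
  have "0 \<le> 1/2 * p x + 1/2 * q x" "0 \<le> 1/2 * p x + (- 1/2) * q x" for x
    using p(2)[of x] by (auto simp: abs_le_iff)
  moreover have "q x = (1/2 * p x + 1/2 * q x) - (1/2 * p x + (- 1/2) * q x)" for x
    by simp
  ultimately show "delta_semidefinite q"
    unfolding delta_semidefinite_def
    using continuous_quadratic_form_linear_combination[OF p(1) q] by blast
qed

section \<open>From a factorization to a majorant\<close>

lemma (in hilbert_space_on) parallelogram_form_inner: "parallelogram_form H (\<lambda>h. ip h h)"
proof
  note mem = subspace_0[OF subspace] subspace_add[OF subspace] subspace_diff[OF subspace]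
    subspace_scale[OF subspace] subspace_neg[OF subspace]
  have zero: "ip 0 h = 0" if "h \<in> H" for h
    using ip_scaleR_left[of 0 h 0] mem(1) that by simp
  show "subspace H" by (rule subspace)
  show "0 \<le> ip f f" if "f \<in> H" for f
    using ip_pos[OF that] zero[OF mem(1)] by (cases "f = 0") auto
  show "ip (c *\<^sub>R f) (c *\<^sub>R f) = c\<^sup>2 * ip f f" if "f \<in> H" for f c
    using that mem by (simp add: ip_scaleR_left ip_commute[of f "c *\<^sub>R f"] power2_eq_square)
  fix f g assume fg: "f \<in> H" "g \<in> H"
  have add: "ip (f + h) (f + h) = ip f f + 2 * ip h f + ip h h" if "h \<in> H" for h
    using that fg mem
    by (simp add: ip_add_left ip_commute[of f "f + h"] ip_commute[of h "f + h"] ip_commute[of f h])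
  have "ip (- g) f = - ip g f" "ip (- g) (- g) = ip g g"
    using ip_scaleR_left[of g f "- 1"] ip_scaleR_left[of g "- g" "- 1"]
      ip_scaleR_left[of g g "- 1"] ip_commute[of g "- g"] fg mem by simp_all
  with add[of g] add[of "- g"] show "ip (f + g) (f + g) + ip (f - g) (f - g) = 2 * ip f f + 2 * ip g g"
    using fg mem by simp
qed

text \<open>
  Continuity of \<open>B\<close> makes every \<open>2 B h x - \<parallel>h\<parallel>\<^sup>2\<close> at most \<open>2 L \<parallel>x\<parallel> \<parallel>h\<parallel> - \<parallel>h\<parallel>\<^sup>2 \<le> (L \<parallel>x\<parallel>)\<^sup>2\<close>, so the energy of
  \<open>x\<close> is a continuous quadratic form; testing it at \<open>A x\<close> and \<open>- A x\<close> controls \<open>\<bar>T x x\<bar>\<close>.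
\<close>

lemma factorizable_imp_dominated:
  fixes T :: "'a::real_normed_vector \<Rightarrow>\<^sub>L 'a \<Rightarrow>\<^sub>L real"
  assumes "factorizable_through_hilbert TYPE('v::real_vector) T"
  shows "\<exists>p. continuous_quadratic_form p \<and> (\<forall>x. \<bar>T x x\<bar> \<le> p x)"
proof -
  obtain H :: "'v set" and ip A B where hilb: "hilbert_space_on H ip"
    and A: "bounded_linear_into H ip A" and B: "bounded_linear_from H ip B"
    and TBA: "\<And>x. T x = B (A x)"
    using assms unfolding factorizable_through_hilbert_def by blast
  interpret H: hilbert_space_on H ip by fact
  interpret N: parallelogram_form H "\<lambda>h. ip h h" by (rule H.parallelogram_form_inner)
  obtain K where "linear A" and A_mem: "\<And>x. A x \<in> H" and "\<And>x. ip_norm ip (A x) \<le> K * norm x"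
    using A unfolding bounded_linear_into_def by blast
  then have A_bound: "ip (A x) (A x) \<le> (K * norm x)\<^sup>2" for x
    using N.nonneg[OF A_mem] by (auto simp: ip_norm_def intro: sqrt_le_D)
  interpret A: linear A by fact
  obtain L where B_add: "\<And>h k. h \<in> H \<Longrightarrow> k \<in> H \<Longrightarrow> B (h + k) = B h + B k"
    and B_scale: "\<And>c h. h \<in> H \<Longrightarrow> B (c *\<^sub>R h) = c *\<^sub>R B h"
    and B_norm: "\<And>h. h \<in> H \<Longrightarrow> norm (B h) \<le> L * ip_norm ip h"
    using B unfolding bounded_linear_from_def by blast
  interpret E: paired_parallelogram_form H "\<lambda>h. ip h h" "\<lambda>x h. B h x"
    by unfold_locales (auto simp: B_add B_scale blinfun.bilinear_simps)
  have bound: "2 * B h x - ip h h \<le> (L * norm x)\<^sup>2" if "h \<in> H" for x h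
  proof -
    have "B h x \<le> norm (B h) * norm x"
      using norm_blinfun[of "B h" x] by simp
    also have "\<dots> \<le> (L * ip_norm ip h) * norm x"
      by (intro mult_right_mono B_norm that) simp
    finally have "2 * B h x \<le> 2 * (L * norm x) * ip_norm ip h"
      by (simp add: mult_ac)
    also have "\<dots> \<le> (L * norm x)\<^sup>2 + (ip_norm ip h)\<^sup>2"
      by (rule sum_squares_bound)
    also have "(ip_norm ip h)\<^sup>2 = ip h h"
      using N.nonneg[OF that] by (simp add: ip_norm_def)
    finally show ?thesis by simp
  qed
  have finite: "x \<in> E.finite_energy" for x
    by (rule E.finite_energyI[OF bound])
  then have "E.finite_energy = UNIV" by blast
  with E.energy.parallelogram_form_axioms have "parallelogram_form UNIV E.energy" by simp
  then have E_form: "continuous_quadratic_form E.energy"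
    by (rule bounded_parallelogram_form_imp_continuous_quadratic_form)
      (rule E.energy_leI[OF bound])
  have "parallelogram_form UNIV (\<lambda>x. ip (A x) (A x))"
    by unfold_locales
      (auto simp: A.add A.diff A.scale A_mem N.nonneg N.scale N.parallelogram)
  then have A_form: "continuous_quadratic_form (\<lambda>x. ip (A x) (A x))"
    by (rule bounded_parallelogram_form_imp_continuous_quadratic_form) (rule A_bound)
  have "\<bar>T x x\<bar> \<le> 1/2 * E.energy x + 1/2 * ip (A x) (A x)" for x
    using E.energy_upper[OF finite, of "A x" x] E.energy_upper[OF finite, of "- A x" x]
      B_scale[OF A_mem, of "- 1" x] A_mem[of x] N.mem(5)[OF A_mem] N.form_minus[OF A_mem]
    by (simp add: TBA abs_le_iff blinfun.minus_left)
  then show ?thesis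
    using continuous_quadratic_form_linear_combination[OF E_form A_form, of "1/2" "1/2"] by blast
qed

section \<open>From a majorant to a factorization\<close>

text \<open>
  The square root of the energy dominates the dual norm up to the factor \<open>K\<close>, so the energy is
  definite and an energy-Cauchy sequence has a limit in the dual; the sequence converges to it in
  energy because the energy is lower semicontinuous.
\<close>

lemma hilbert_space_finite_energy:
  fixes p :: "'a::real_normed_vector \<Rightarrow> real"
  defines "\<beta> \<equiv> (blinfun_apply :: ('a \<Rightarrow>\<^sub>L real) \<Rightarrow> 'a \<Rightarrow> real)"
  assumes "paired_parallelogram_form UNIV p \<beta>"
    and "0 \<le> K" and sqrt_p: "\<And>x. sqrt (p x) \<le> K * norm x"
  shows "hilbert_space_on (paired_parallelogram_form.finite_energy UNIV p \<beta>)
    (parallelogram_form.polar (paired_parallelogram_form.energy UNIV p \<beta>))"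
proof -
  interpret E: paired_parallelogram_form UNIV p "blinfun_apply :: ('a \<Rightarrow>\<^sub>L real) \<Rightarrow> 'a \<Rightarrow> real"
    using assms(2) unfolding \<beta>_def .
  define H where "H = E.finite_energy"
  define ip where "ip = E.energy.polar"
  have norm_ip: "ip_norm ip f = sqrt (E.energy f)" if "f \<in> H" for f
    using that by (simp add: ip_norm_def ip_def H_def E.energy.polar_self)
  have apply_le: "\<bar>f x\<bar> \<le> sqrt (E.energy f) * K * norm x" if "f \<in> H" for f x
  proof -
    have "\<bar>f x\<bar> \<le> sqrt (E.energy f) * sqrt (p x)"
      using real_sqrt_le_mono[OF E.pair_square_le_energy[of f x]] that
      by (simp add: H_def real_sqrt_mult)
    also have "\<dots> \<le> sqrt (E.energy f) * (K * norm x)"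
      using that by (intro mult_left_mono sqrt_p) (simp add: H_def E.energy_nonneg)
    finally show ?thesis by simp
  qed
  then have norm_le: "norm f \<le> K * sqrt (E.energy f)" if "f \<in> H" for f
    using that \<open>0 \<le> K\<close>
    by (intro norm_blinfun_bound) (auto simp: H_def E.energy_nonneg mult_ac)

  have "hilbert_space_on H ip"
  proof
    show "subspace H" unfolding H_def by (rule E.subspace_finite_energy)
    show "ip f g = ip g f" if "f \<in> H" "g \<in> H" for f g
      using that E.energy.polar_commute by (simp add: H_def ip_def)
    show "ip (f + g) h = ip f h + ip g h" if "f \<in> H" "g \<in> H" "h \<in> H" for f g h
      using that E.energy.polar_add_left by (simp add: H_def ip_def)
    show "ip (c *\<^sub>R f) g = c * ip f g" if "f \<in> H" "g \<in> H" for c f g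
      using that E.energy.polar_scale_left by (simp add: H_def ip_def)
    show "0 < ip f f" if "f \<in> H" "f \<noteq> 0" for f
    proof -
      have "0 < norm f" using that by simp
      with norm_le[OF that(1)] have "E.energy f \<noteq> 0" by auto
      with that show ?thesis
        using E.energy_nonneg[of f] by (simp add: H_def ip_def E.energy.polar_self)
    qed
    fix s :: "nat \<Rightarrow> 'a \<Rightarrow>\<^sub>L real"
    assume s: "\<And>n. s n \<in> H"
      and Cau: "\<And>e. 0 < e \<Longrightarrow> \<exists>N. \<forall>m\<ge>N. \<forall>n\<ge>N. ip_norm ip (s m - s n) < e"
    have diff: "s m - s n \<in> H" for m n
      using s E.energy.mem(3) by (simp add: H_def)
    have "Cauchy s"
    proof (rule CauchyI)
      fix e :: real
      assume "0 < e"
      define d where "d = e / (K + 1)"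
      have "0 < K + 1"
        using \<open>0 \<le> K\<close> by (intro add_nonneg_pos) auto
      then have "0 < d" and d: "K * d < e"
        using \<open>0 < e\<close> by (auto simp: d_def field_simps)
      obtain M where M: "\<And>m n. m \<ge> M \<Longrightarrow> n \<ge> M \<Longrightarrow> ip_norm ip (s m - s n) < d"
        using Cau[OF \<open>0 < d\<close>] by blast
      have "norm (s m - s n) < e" if "m \<ge> M" "n \<ge> M" for m n
      proof -
        have "norm (s m - s n) \<le> K * ip_norm ip (s m - s n)"
          using norm_le[OF diff] norm_ip[OF diff] by simp
        also have "\<dots> \<le> K * d"
          using M[OF that] \<open>0 \<le> K\<close> by (intro mult_left_mono) auto
        finally show ?thesis using d by simp
      qed
      then show "\<exists>M. \<forall>m\<ge>M. \<forall>n\<ge>M. norm (s m - s n) < e" by blast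
    qed
    then obtain l where l: "s \<longlonglongrightarrow> l"
      using Cauchy_convergent convergent_def by blast
    \<comment> \<open>The energy is a supremum of continuous functions of the functional, so it is lower
      semicontinuous: a bound on the energy of \<open>s n - s m\<close> for all large \<open>m\<close> passes to \<open>s n - l\<close>.\<close>
    have tail: "\<exists>M. \<forall>n\<ge>M. s n - l \<in> H \<and> E.energy (s n - l) \<le> e\<^sup>2" if "0 < e" for e
    proof -
      obtain M where M: "\<And>m n. m \<ge> M \<Longrightarrow> n \<ge> M \<Longrightarrow> ip_norm ip (s m - s n) < e"
        using Cau[OF \<open>0 < e\<close>] by blast
      have "2 * (s n - l) x - p x \<le> e\<^sup>2" if "n \<ge> M" for n x
      proof (rule LIMSEQ_le_const2)
        show "(\<lambda>m. 2 * (s n - s m) x - p x) \<longlonglongrightarrow> 2 * (s n - l) x - p x"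
          by (intro tendsto_intros l)
        have "2 * (s n - s m) x - p x \<le> e\<^sup>2" if "m \<ge> M" for m
        proof -
          have "sqrt (E.energy (s n - s m)) \<le> e"
            using M[OF \<open>n \<ge> M\<close> that] norm_ip[OF diff] by simp
          then have "E.energy (s n - s m) \<le> e\<^sup>2"
            by (rule sqrt_le_D)
          with E.energy_upper[of "s n - s m" x] diff show ?thesis
            by (fastforce simp: H_def)
        qed
        then show "\<exists>N. \<forall>m\<ge>N. 2 * (s n - s m) x - p x \<le> e\<^sup>2" by blast
      qed
      then show ?thesis
        unfolding H_def by (meson E.finite_energyI E.energy_leI)
    qed
    have "l \<in> H"
    proof -
      obtain n where "s n - l \<in> H" using tail[of 1] by force
      then show ?thesis
        using E.energy.mem(3)[of "s n" "s n - l"] s by (simp add: H_def)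
    qed
    moreover have "(\<lambda>n. ip_norm ip (s n - l)) \<longlonglongrightarrow> 0"
    proof (rule LIMSEQ_I)
      fix e :: real
      assume "0 < e"
      then obtain M where M: "\<And>n. n \<ge> M \<Longrightarrow> s n - l \<in> H \<and> E.energy (s n - l) \<le> (e/2)\<^sup>2"
        using tail[of "e/2"] by auto
      have "norm (ip_norm ip (s n - l) - 0) < e" if "n \<ge> M" for n
      proof -
        have "sqrt (E.energy (s n - l)) \<le> e/2"
          using M[OF that] \<open>0 < e\<close> by (intro real_le_lsqrt) auto
        with M[OF that] \<open>0 < e\<close> show ?thesis
          by (simp add: norm_ip H_def E.energy_nonneg)
      qed
      then show "\<exists>M. \<forall>n\<ge>M. norm (ip_norm ip (s n - l) - 0) < e" by blast
    qed
    ultimately show "\<exists>l\<in>H. (\<lambda>n. ip_norm ip (s n - l)) \<longlonglongrightarrow> 0" by blast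
  qed
  then show ?thesis
    by (simp add: H_def ip_def \<beta>_def)
qed

text \<open>
  The majorant \<open>p\<close> enters twice: its polar form is the reproducing kernel of the Hilbert space, and it
  bounds the energy of every \<open>T y\<close>.
\<close>

lemma dominated_imp_factorizable:
  fixes T :: "'a::real_normed_vector \<Rightarrow>\<^sub>L 'a \<Rightarrow>\<^sub>L real"
  assumes sym: "symmetric_operator T"
    and p: "continuous_quadratic_form p" and dom: "\<And>x. \<bar>T x x\<bar> \<le> p x"
  shows "factorizable_through_hilbert TYPE('a \<Rightarrow>\<^sub>L real) T"
proof -
  obtain b where b: "bounded_bilinear b" and p_eq: "\<And>x. p x = b x x"
    using p unfolding continuous_quadratic_form_def by blast
  interpret b: bounded_bilinear b by fact
  have p_nonneg: "0 \<le> p x" for x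
    using dom[of x] by linarith
  interpret p: parallelogram_form UNIV p
    by unfold_locales
      (auto simp: p_eq b.add_left b.add_right b.diff_left b.diff_right b.scaleR_left b.scaleR_right
        power2_eq_square intro: p_nonneg[unfolded p_eq])
  interpret E: paired_parallelogram_form UNIV p "blinfun_apply :: ('a \<Rightarrow>\<^sub>L real) \<Rightarrow> 'a \<Rightarrow> real"
    by unfold_locales (auto simp: blinfun.bilinear_simps)
  define H where "H = E.finite_energy"
  define ip where "ip = E.energy.polar"
  obtain K where "0 \<le> K" and "\<And>x. norm (b x x) \<le> norm x * norm x * K"
    using b.nonneg_bounded by blast
  then have "p x \<le> norm x * norm x * K" for x
    using p_eq by (metis abs_le_D1 real_norm_def)
  then have sqrt_p: "sqrt (p x) \<le> sqrt K * norm x" for x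
    by (metis mult.commute norm_ge_zero real_sqrt_abs2 abs_of_nonneg real_sqrt_le_mono real_sqrt_mult)
  have norm_ip: "ip_norm ip f = sqrt (E.energy f)" if "f \<in> H" for f
    using that by (simp add: ip_norm_def ip_def H_def E.energy.polar_self)
  have hilb: "hilbert_space_on H ip"
    unfolding H_def ip_def
    by (rule hilbert_space_finite_energy[where K = "sqrt K"])
      (use \<open>0 \<le> K\<close> sqrt_p E.paired_parallelogram_form_axioms in auto)

  define A where "A x = Blinfun (\<lambda>y. p.polar x y)" for x
  have polar_eq: "p.polar x y = (b x y + b y x) / 2" for x y
    by (simp add: p.polar_def p_eq b.add_left b.add_right b.diff_left b.diff_right)
  have "bounded_linear (\<lambda>y. (b x y + b y x) / 2)" for x
    using bounded_linear_compose[OF bounded_linear_divide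
        bounded_linear_add[OF b.bounded_linear_right b.bounded_linear_left]] .
  then have A_apply: "A x y = p.polar x y" for x y
    unfolding A_def polar_eq by (simp add: bounded_linear_Blinfun_apply)
  have A_mem: "A x \<in> H" for x
    unfolding H_def by (rule E.representer_finite_energy[of x]) (auto simp: A_apply)
  have reproducing: "ip f (A x) = f x" if "f \<in> H" for f x
    using that unfolding H_def ip_def
    by (intro E.energy_polar_representer(1)) (auto simp: A_apply)
  have A_energy: "E.energy (A x) = p x" for x
    by (rule E.energy_polar_representer(2)[OF E.energy.mem(1)]) (auto simp: A_apply)
  have A: "bounded_linear_into H ip A"
    unfolding bounded_linear_into_def
  proof (intro conjI exI allI)
    show "linear A"
      by (rule linearI)
        (auto intro!: blinfun_eqI simp: A_apply blinfun.bilinear_simps p.polar_add_left p.polar_scale_left)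
    show "range A \<subseteq> H" using A_mem by blast
    show "ip_norm ip (A x) \<le> sqrt K * norm x" for x
      using sqrt_p by (simp add: norm_ip A_mem A_energy)
  qed

  have T_le: "2 * T y x - p x \<le> p y" for x y
  proof -
    have "T x y = T y x"
      using sym by (simp add: symmetric_operator_def)
    then have "4 * T y x = T (x + y) (x + y) - T (x - y) (x - y)"
      by (simp add: blinfun.bilinear_simps)
    also have "\<dots> \<le> p (x + y) + p (x - y)"
      using dom[of "x + y"] dom[of "x - y"] by linarith
    also have "\<dots> = 2 * p x + 2 * p y"
      by (rule p.parallelogram) auto
    finally show ?thesis by simp
  qed
  have T_mem: "T y \<in> H" for y
    unfolding H_def by (rule E.finite_energyI[OF T_le])
  have T_energy: "E.energy (T y) \<le> p y" for y
    by (rule E.energy_leI[OF T_le])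
  have ip_T_le: "\<bar>ip f (T y)\<bar> \<le> sqrt K * sqrt (E.energy f) * norm y" if "f \<in> H" for f y
  proof -
    have "\<bar>ip f (T y)\<bar> \<le> sqrt (E.energy f) * sqrt (E.energy (T y))"
      using that T_mem E.energy.polar_Cauchy_Schwarz by (simp add: H_def ip_def)
    also have "\<dots> \<le> sqrt (E.energy f) * (sqrt K * norm y)"
      using that order_trans[OF real_sqrt_le_mono[OF T_energy] sqrt_p]
      by (intro mult_left_mono) (auto simp: H_def E.energy_nonneg)
    finally show ?thesis by (simp add: mult_ac)
  qed
  define B where "B f = Blinfun (\<lambda>y. ip f (T y))" for f
  have B_apply: "B f y = ip f (T y)" if "f \<in> H" for f y
  proof -
    have "bounded_linear (\<lambda>y. ip f (T y))"
    proof (rule bounded_linear_intro)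
      show "ip f (T (x + y)) = ip f (T x) + ip f (T y)" for x y
        using that T_mem by (simp add: H_def ip_def blinfun.add_right E.energy.polar_add_right)
      show "ip f (T (c *\<^sub>R x)) = c *\<^sub>R ip f (T x)" for c x
        using that T_mem by (simp add: H_def ip_def blinfun.scaleR_right E.energy.polar_scale_right)
      show "norm (ip f (T y)) \<le> norm y * (sqrt K * sqrt (E.energy f))" for y
        using ip_T_le[OF that, of y] by (simp add: mult_ac)
    qed
    then show ?thesis
      unfolding B_def by (simp add: bounded_linear_Blinfun_apply)
  qed
  have B: "bounded_linear_from H ip B"
    unfolding bounded_linear_from_def
  proof (intro conjI ballI allI exI)
    show "B (f + g) = B f + B g" if "f \<in> H" "g \<in> H" for f g
    proof (rule blinfun_eqI)
      have "f + g \<in> H" using that E.finite_energy_add by (simp add: H_def)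
      then show "B (f + g) y = (B f + B g) y" for y
        using that T_mem[of y]
        by (simp add: B_apply blinfun.add_left) (simp add: H_def ip_def E.energy.polar_add_left)
    qed
    show "B (c *\<^sub>R f) = c *\<^sub>R B f" if "f \<in> H" for c f
    proof (rule blinfun_eqI)
      have "c *\<^sub>R f \<in> H" using that E.finite_energy_scale by (simp add: H_def)
      then show "B (c *\<^sub>R f) y = (c *\<^sub>R B f) y" for y
        using that T_mem[of y]
        by (simp add: B_apply blinfun.scaleR_left) (simp add: H_def ip_def E.energy.polar_scale_left)
    qed
    show "norm (B f) \<le> sqrt K * ip_norm ip f" if "f \<in> H" for f
      using that \<open>0 \<le> K\<close> ip_T_le[OF that]
      by (intro norm_blinfun_bound) (auto simp: norm_ip B_apply H_def E.energy_nonneg)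
  qed

  have "T x = B (A x)" for x
  proof (rule blinfun_eqI)
    fix y
    have "B (A x) y = ip (T y) (A x)"
      using A_mem T_mem E.energy.polar_commute by (simp add: B_apply) (simp add: H_def ip_def)
    also have "\<dots> = T x y"
      using sym by (simp add: reproducing[OF T_mem] symmetric_operator_def)
    finally show "T x y = B (A x) y" ..
  qed
  with hilb A B show ?thesis
    unfolding factorizable_through_hilbert_def by blast
qed

theorem theorem1p2:
  fixes q :: "'a::banach \<Rightarrow> real"
    and T :: "'a \<Rightarrow>\<^sub>L 'a \<Rightarrow>\<^sub>L real"
  assumes "continuous_quadratic_form q"
    and "symmetric_operator T"
    and "generates T q"
  shows "(delta_semidefinite q \<longleftrightarrow>
            (\<exists>p. continuous_quadratic_form p \<and> (\<forall>x. \<bar>q x\<bar> \<le> p x))) \<and>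
         (delta_semidefinite q \<longleftrightarrow>
            factorizable_through_hilbert TYPE('a \<Rightarrow>\<^sub>L real) T) \<and>
         (factorizable_through_hilbert TYPE('v::real_vector) T \<longrightarrow> delta_semidefinite q)"
proof -
  have q: "q x = T x x" for x
    using assms(3) by (simp add: generates_def)
  note dominated = delta_semidefinite_iff_dominated[OF assms(1)]
  have "factorizable_through_hilbert TYPE('a \<Rightarrow>\<^sub>L real) T" if "delta_semidefinite q"
    using that dominated_imp_factorizable[OF assms(2)] unfolding dominated q by blast
  moreover have "delta_semidefinite q" if "factorizable_through_hilbert TYPE('a \<Rightarrow>\<^sub>L real) T"
    using factorizable_imp_dominated[OF that] unfolding dominated q .
  moreover have "delta_semidefinite q" if "factorizable_through_hilbert TYPE('v) T"
    using factorizable_imp_dominated[OF that] unfolding dominated q .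
  ultimately show ?thesis
    using dominated by blast
qed

end
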